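(* Let $d\mathbf{x}/dt=F_\varepsilon(\mathbf{x})$ be a one-parameter family of systems on $\mathbb{R}^n$ with limit cycles $\gamma_\varepsilon$, and write $F=F_0$, $\gamma=\gamma_0$. Let region I be a region bounded by an entry surface $\Sigma^{\rm in}$ and an exit surface $\Sigma^{\rm out}$, both independent of $\varepsilon$ and transverse to $\gamma$. Suppose $\gamma$ enters region I through $\Sigma^{\rm in}$ at the point $\mathbf{x}^{\rm in}$ at time $t^{\rm in}$ and exits through $\Sigma^{\rm out}$ at the point $\mathbf{x}^{\rm out}$ at time $t^{\rm out}$. Suppose $\gamma_\varepsilon$ enters region I at the point $\mathbf{x}^{\rm in}_\varepsilon\in\Sigma^{\rm in}$ and spends time $T^{\rm I}_\varepsilon$ in region I, where $$T^{\rm I}_\varepsilon=T^{\rm I}_0+\varepsilon T^{\rm I}_1+O(\varepsilon^2),\qquad T^{\rm I}_0=t^{\rm out}-t^{\rm in}.$$ Let $\eta^{\rm I}=\nabla\mathcal{T}^{\rm I}$ be the local timing response curve of region I. Then $$T^{\rm I}_1=\eta^{\rm I}(\mathbf{x}^{\rm in})\cdot\frac{\partial\mathbf{x}^{\rm in}_\varepsilon}{\partial\varepsilon}\Big|_{\varepsilon=0}+\int_{t^{\rm in}}^{t^{\rm out}}\eta^{\rm I}(\gamma(t))\cdot\frac{\partial F_\varepsilon(\gamma(t))}{\partial\varepsilon}\Big|_{\varepsilon=0}\,dt.$$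
   Context: Standing assumptions: $F_\varepsilon(\mathbf{x})$ is $C^1$ in both $\mathbf{x}\in\Omega$ (with $\Omega\subset\mathbb{R}^n$ open) and $\varepsilon$ in a small open neighborhood of $0$. For each such $\varepsilon$ the system $d\mathbf{x}/dt=F_\varepsilon(\mathbf{x})$ has a linearly asymptotically stable limit cycle $\gamma_\varepsilon(t)$ with finite period depending at least $C^1$ on $\varepsilon$, and $\gamma_\varepsilon$ agrees with $\gamma_0+O(\varepsilon)$ uniformly in time after a suitable $\varepsilon$-dependent rescaling of time. The entry point has an expansion $\mathbf{x}^{\rm in}_\varepsilon=\mathbf{x}^{\rm in}+\varepsilon\,\frac{\partial\mathbf{x}^{\rm in}_\varepsilon}{\partial\varepsilon}\big|_{\varepsilon=0}+O(\varepsilon^2)$. Local timing response curve (lTRC): for $\mathbf{x}$ in region I (at least in an open neighborhood of the part of $\gamma$ in region I), $\mathcal{T}^{\rm I}(\mathbf{x})$ is the time remaining until the trajectory starting at $\mathbf{x}$ under the unperturbed vector field $F_0$ exits region I through $\Sigma^{\rm out}$; thus $\mathcal{T}^{\rm I}=0$ on $\Sigma^{\rm out}$ and $F_0\cdot\nabla\mathcal{T}^{\rm I}=-1$. The lTRC is $\eta^{\rm I}(\mathbf{x})=\nabla\mathcal{T}^{\rm I}(\mathbf{x})$, considered along $\gamma(t)$ for $t\in[t^{\rm in},t^{\rm out}]$. Let $\mathcal{T}_\varepsilon(\mathbf{x})$ denote the time remaining under $F_\varepsilon$ (so $\mathcal{T}_0=\mathcal{T}^{\rm I}$) and $\eta_\varepsilon=\nabla\mathcal{T}_\varepsilon$.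 It is supposed that $F_\varepsilon$, $\mathcal{T}_\varepsilon$ and $\eta_\varepsilon$ have first-order expansions in $\varepsilon$ with $O(\varepsilon^2)$ remainders as $\varepsilon\to0$. *)

theory Defs
  imports "HOL-Analysis.Analysis" "HOL-Library.Landau_Symbols"
begin

definition first_order_expansion :: "(real \<Rightarrow> 'a::real_normed_vector) \<Rightarrow> 'a \<Rightarrow> bool" where
  "first_order_expansion f c \<longleftrightarrow>
     (\<lambda>\<epsilon>. norm (f \<epsilon> - f 0 - \<epsilon> *\<^sub>R c)) \<in> O[at 0](\<lambda>\<epsilon>. \<epsilon>\<^sup>2)"

text \<open>\<open>C\<^sup>1\<close> maps on an open set; the library's \<open>C1_differentiable_on\<close> covers only functions
  of one real variable.\<close>

definition C1_map_on ::
    "('a::real_normed_vector \<Rightarrow> 'b::real_normed_vector) \<Rightarrow> 'a set \<Rightarrow> bool" where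
  "C1_map_on f S \<longleftrightarrow>
     (\<exists>f' :: 'a \<Rightarrow> 'a \<Rightarrow>\<^sub>L 'b.
        (\<forall>x\<in>S. (f has_derivative blinfun_apply (f' x)) (at x)) \<and> continuous_on S f')"

definition trajectory_on ::
    "('a::real_normed_vector \<Rightarrow> 'a) \<Rightarrow> 'a set \<Rightarrow> (real \<Rightarrow> 'a) \<Rightarrow> real set \<Rightarrow> bool" where
  "trajectory_on G D u I \<longleftrightarrow>
     (\<forall>t\<in>I. u t \<in> D \<and> (u has_vector_derivative G (u t)) (at t within I))"


text \<open>A periodic orbit with minimal period \<open>P\<close>; minimality rules out equilibria. That the orbit is
  isolated follows from \<open>linearly_asymptotically_stable\<close> below, which is always assumed with it.\<close>

definition periodic_orbit ::
    "('a::real_normed_vector \<Rightarrow> 'a) \<Rightarrow> 'a set \<Rightarrow> (real \<Rightarrow> 'a) \<Rightarrow> real \<Rightarrow> bool" where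
  "periodic_orbit G D u P \<longleftrightarrow>
     trajectory_on G D u UNIV \<and> P > 0 \<and> (\<forall>t. u (t + P) = u t) \<and>
     (\<forall>p. 0 < p \<and> p < P \<longrightarrow> (\<exists>t. u (t + p) \<noteq> u t))"

definition complex_charpoly :: "real^'n^'n \<Rightarrow> complex poly" where
  "complex_charpoly M =
     det (\<chi> i j. (if i = j then [:0, 1:] else 0) - [:complex_of_real (M $ i $ j):])"

text \<open>The principal fundamental matrix of the variational equation along \<open>u\<close>, evaluated at \<open>P\<close>.\<close>

definition is_monodromy ::
    "(real^'n \<Rightarrow> real^'n) \<Rightarrow> (real \<Rightarrow> real^'n) \<Rightarrow> real \<Rightarrow> real^'n^'n \<Rightarrow> bool" where
  "is_monodromy G u P M \<longleftrightarrow>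
     (\<exists>\<Phi>. \<Phi> 0 = mat 1 \<and> \<Phi> P = M \<and>
        (\<forall>t. (\<Phi> has_vector_derivative (jacobian G (at (u t)) ** \<Phi> t)) (at t)))"

text \<open>The trivial Floquet multiplier 1 is simple and all others lie inside the unit circle.\<close>

definition linearly_asymptotically_stable ::
    "(real^'n \<Rightarrow> real^'n) \<Rightarrow> (real \<Rightarrow> real^'n) \<Rightarrow> real \<Rightarrow> bool" where
  "linearly_asymptotically_stable G u P \<longleftrightarrow>
     (\<exists>M. is_monodromy G u P M \<and> order 1 (complex_charpoly M) = 1 \<and>
        (\<forall>z. poly (complex_charpoly M) z = 0 \<and> z \<noteq> 1 \<longrightarrow> cmod z < 1))"

definition stable_limit_cycle ::
    "(real^'n \<Rightarrow> real^'n) \<Rightarrow> (real^'n) set \<Rightarrow> (real \<Rightarrow> real^'n) \<Rightarrow> real \<Rightarrow> bool" where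
  "stable_limit_cycle G D u P \<longleftrightarrow>
     periodic_orbit G D u P \<and> linearly_asymptotically_stable G u P"


text \<open>Near \<open>p\<close>, the set \<open>S\<close> is the regular zero set of \<open>\<phi>\<close>, and \<open>g\<close> is the gradient of \<open>\<phi>\<close>.\<close>

definition local_equation ::
    "'a::real_inner set \<Rightarrow> 'a \<Rightarrow> ('a \<Rightarrow> real) \<Rightarrow> ('a \<Rightarrow> 'a) \<Rightarrow> bool" where
  "local_equation S p \<phi> g \<longleftrightarrow>
     (\<exists>N. open N \<and> p \<in> N \<and> (\<forall>x\<in>N. GDERIV \<phi> x :> g x \<and> g x \<noteq> 0) \<and> continuous_on N g \<and>
        S \<inter> N = {x \<in> N. \<phi> x = 0})"

definition C1_hypersurface :: "'a::real_inner set \<Rightarrow> bool" where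
  "C1_hypersurface S \<longleftrightarrow> (\<forall>p\<in>S. \<exists>\<phi> g. local_equation S p \<phi> g)"

text \<open>\<open>S\<close> is transverse to the trajectory \<open>u\<close> of \<open>G\<close>: wherever they meet, the velocity is not
  tangent to \<open>S\<close>.\<close>

definition transverse_to ::
    "'a::real_inner set \<Rightarrow> ('a \<Rightarrow> 'a) \<Rightarrow> (real \<Rightarrow> 'a) \<Rightarrow> bool" where
  "transverse_to S G u \<longleftrightarrow>
     (\<forall>t. u t \<in> S \<longrightarrow> (\<exists>\<phi> g. local_equation S (u t) \<phi> g \<and> g (u t) \<bullet> G (u t) \<noteq> 0))"


text \<open>A region \<open>R\<close> is an open set, and \<open>Sin\<close>, \<open>Sout\<close> are parts of its frontier. The curve \<open>u\<close>
  enters \<open>R\<close> through \<open>Sin\<close> at time \<open>t1\<close> and next leaves it through \<open>Sout\<close> at time \<open>t2\<close>.\<close>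

definition passes_through ::
    "'a::topological_space set \<Rightarrow> 'a set \<Rightarrow> 'a set \<Rightarrow> (real \<Rightarrow> 'a) \<Rightarrow> real \<Rightarrow> real \<Rightarrow> bool" where
  "passes_through R Sin Sout u t1 t2 \<longleftrightarrow>
     t1 < t2 \<and> u t1 \<in> Sin \<and> u t2 \<in> Sout \<and> (\<forall>t\<in>{t1<..<t2}. u t \<in> R) \<and>
     (\<forall>\<^sub>F t in at_left t1. u t \<notin> R) \<and> (\<forall>\<^sub>F t in at_right t2. u t \<notin> R)"

text \<open>The trajectory of \<open>G\<close> starting at \<open>x\<close> leaves \<open>R\<close> through \<open>Sout\<close> after time \<open>\<tau>\<close>. The point
  \<open>x\<close> may itself lie on the frontier of \<open>R\<close>; if \<open>x \<in> Sout\<close> then \<open>\<tau> = 0\<close>.\<close>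

definition exits_after ::
    "('a::real_normed_vector \<Rightarrow> 'a) \<Rightarrow> 'a set \<Rightarrow> 'a set \<Rightarrow> 'a set \<Rightarrow> 'a \<Rightarrow> real \<Rightarrow> bool" where
  "exits_after G D R Sout x \<tau> \<longleftrightarrow>
     0 \<le> \<tau> \<and>
     (\<exists>u. trajectory_on G D u {0..\<tau>} \<and> u 0 = x \<and> u \<tau> \<in> Sout \<and>
        (\<forall>s\<in>{0..<\<tau>}. u s \<notin> Sout) \<and> (\<forall>s\<in>{0<..<\<tau>}. u s \<in> R))"

text \<open>\<open>T\<close> is the time remaining in the region and \<open>\<eta>\<close> its (continuous) gradient, the local timing
  response curve. Both live on an open set \<open>U\<close>, so that gradients make sense on the bounding
  surfaces; the values of \<open>T\<close> are prescribed at the points of \<open>U\<close> in the region or on its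
  bounding surfaces.\<close>

definition local_timing_response ::
    "('a::real_inner \<Rightarrow> 'a) \<Rightarrow> 'a set \<Rightarrow> 'a set \<Rightarrow> 'a set \<Rightarrow> 'a set \<Rightarrow> 'a set \<Rightarrow>
     ('a \<Rightarrow> real) \<Rightarrow> ('a \<Rightarrow> 'a) \<Rightarrow> bool" where
  "local_timing_response G D R Sin Sout U T \<eta> \<longleftrightarrow>
     (\<forall>x \<in> U \<inter> (R \<union> Sin \<union> Sout). exits_after G D R Sout x (T x)) \<and>
     (\<forall>x\<in>U. GDERIV T x :> \<eta> x) \<and> continuous_on U \<eta>"

end

theory Submission
  imports Defs
begin

text \<open>
  The proof follows the perturbed orbit with the clock of the unperturbed system. Let \<open>T\<close> be the
  unperturbed remaining time \<open>\<T> 0\<close>, with gradient \<open>\<eta>\<close>, and let \<open>v \<epsilon> s\<close> be the position on the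
  perturbed cycle after time \<open>s\<close> in the region. Inside the region \<open>T\<close> satisfies the transport
  equation \<open>\<eta> \<bullet> F 0 = -1\<close> (\<open>timing_transport_equation\<close>), and \<open>T\<close> vanishes on the exit surface,
  which does not depend on \<open>\<epsilon>\<close>. Integrating the derivative of \<open>T (v \<epsilon> s)\<close> over the transit gives
  the identity, exact for all small \<open>\<epsilon>\<close>,
    \<open>TI \<epsilon> = T (xin \<epsilon>) + (integral over 0 \<le> s \<le> TI \<epsilon> of \<eta> (v \<epsilon> s) \<bullet> (F \<epsilon> - F 0) (v \<epsilon> s))\<close>.
  The first term has derivative \<open>\<eta> (xin 0) \<bullet> xin'\<close> at \<open>\<epsilon> = 0\<close>. In the second the factor
  \<open>F \<epsilon> - F 0\<close> is already of order \<open>\<epsilon>\<close>, so to first order the orbit, \<open>\<eta>\<close> and the upper limit may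
  be replaced by their unperturbed values, which leaves the integral of the theorem.

  Making the replacement rigorous needs \<open>v \<epsilon> \<rightarrow> v 0\<close> uniformly on a compact time interval. It
  comes from convergence of the entry points and a Gronwall estimate in a tube around the unperturbed
  orbit (\<open>trajectory_dependence\<close>), which also yields the uniqueness of trajectories behind the
  transport equation. The limit itself is taken in \<open>transit_time_derivative\<close>, in terms of an
  antiderivative instead of the integral along the perturbed orbit.
\<close>

section \<open>Uniform estimates near a compact set\<close>

text \<open>Heine--Cantor only compares points of the compact set itself. Here the second point may leave
  \<open>K\<close>, as a perturbed orbit leaves the unperturbed one; a Lebesgue number of a cover of \<open>K\<close> by
  open sets on which \<open>q\<close> oscillates by less than \<open>\<kappa>\<close> gives the radius.\<close>

lemma uniformly_continuous_near_compact:
  fixes q :: "'a::metric_space \<Rightarrow> 'b::metric_space"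
  assumes "open W" "compact K" "K \<subseteq> W" "continuous_on W q" "0 < \<kappa>"
  obtains \<delta> where "0 < \<delta>"
    "\<And>p p'. p \<in> K \<Longrightarrow> dist p' p < \<delta> \<Longrightarrow> p' \<in> W \<and> dist (q p') (q p) < \<kappa>"
proof -
  define \<G> where "\<G> = {G. open G \<and> G \<subseteq> W \<and> (\<forall>p\<in>G. \<forall>p'\<in>G. dist (q p') (q p) < \<kappa>)}"
  have "K \<subseteq> \<Union>\<G>"
  proof
    fix p assume "p \<in> K"
    then have p: "p \<in> W" using assms by auto
    define G where "G = W \<inter> q -` ball (q p) (\<kappa>/2)"
    have "open G"
      unfolding G_def by (rule continuous_open_preimage[OF assms(4,1) open_ball])
    moreover have "\<forall>a\<in>G. \<forall>b\<in>G. dist (q b) (q a) < \<kappa>"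
    proof (intro ballI)
      fix a c assume "a \<in> G" "c \<in> G"
      then have "dist (q p) (q c) < \<kappa>/2" "dist (q p) (q a) < \<kappa>/2" unfolding G_def by auto
      then show "dist (q c) (q a) < \<kappa>" by (rule dist_triangle_half_r)
    qed
    moreover have "p \<in> G" using p \<open>0 < \<kappa>\<close> by (simp add: G_def)
    ultimately show "p \<in> \<Union>\<G>" unfolding \<G>_def G_def by auto
  qed
  then obtain \<delta> where \<delta>: "0 < \<delta>" "\<And>p. p \<in> K \<Longrightarrow> \<exists>G\<in>\<G>. ball p \<delta> \<subseteq> G"
    using Heine_Borel_lemma[OF \<open>compact K\<close>, of \<G>] unfolding \<G>_def by blast
  show thesis
  proof (rule that[OF \<delta>(1)])
    fix p p' assume "p \<in> K" "dist p' p < \<delta>"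
    then obtain G where "G \<in> \<G>" "ball p \<delta> \<subseteq> G" using \<delta> by blast
    moreover have "p \<in> ball p \<delta>" "p' \<in> ball p \<delta>"
      using \<delta>(1) \<open>dist p' p < \<delta>\<close> by (auto simp: dist_commute)
    ultimately have "G \<in> \<G>" "p \<in> G" "p' \<in> G" by auto
    then show "p' \<in> W \<and> dist (q p') (q p) < \<kappa>" unfolding \<G>_def by auto
  qed
qed

text \<open>A \<open>C\<^sup>1\<close> map need not be Lipschitz on an open set, but comparison with points of a compact
  reference orbit is all that Gronwall's argument uses. The derivative is bounded on a tube around
  \<open>K\<close>, and each ball of the tube is convex, so the mean value inequality applies.\<close>

lemma C1_lipschitz_near_compact:
  fixes f :: "'a::real_normed_vector \<Rightarrow> 'b::real_normed_vector"
  assumes "C1_map_on f W" "open W" "compact K" "K \<subseteq> W"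
  obtains \<delta> L where "0 < \<delta>" "0 \<le> L"
    "\<And>p p'. p \<in> K \<Longrightarrow> dist p' p < \<delta> \<Longrightarrow> p' \<in> W \<and> norm (f p' - f p) \<le> L * norm (p' - p)"
proof -
  obtain f' where f': "\<And>x. x \<in> W \<Longrightarrow> (f has_derivative blinfun_apply (f' x)) (at x)"
    and cont: "continuous_on W f'"
    using assms unfolding C1_map_on_def by blast
  obtain \<delta> where \<delta>: "0 < \<delta>" 
    "\<And>p p'. p \<in> K \<Longrightarrow> dist p' p < \<delta> \<Longrightarrow> p' \<in> W \<and> dist (f' p') (f' p) < 1"
    using uniformly_continuous_near_compact[OF assms(2-4) cont zero_less_one] by blast
  have "bounded (f' ` K)"
    using assms cont by (meson compact_continuous_image compact_imp_bounded continuous_on_subset)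
  then obtain B where B: "0 < B" "\<And>p. p \<in> K \<Longrightarrow> norm (f' p) \<le> B"
    unfolding bounded_pos by auto
  show thesis
  proof (rule that[OF \<delta>(1), of "B + 1"])
    show "0 \<le> B + 1" using B by simp
    fix p p' assume p: "p \<in> K" "dist p' p < \<delta>"
    have "norm (f p' - f p) \<le> (B + 1) * norm (p' - p)"
    proof (rule differentiable_bound[of "ball p \<delta>" f "\<lambda>x. blinfun_apply (f' x)"])
      fix x assume x: "x \<in> ball p \<delta>"
      then have "x \<in> W" "dist (f' x) (f' p) < 1" using \<delta>(2)[OF p(1), of x] by (auto simp: dist_commute)
      then show "(f has_derivative blinfun_apply (f' x)) (at x within ball p \<delta>)"
        using f' has_derivative_at_withinI by blast
      have "norm (f' x) \<le> norm (f' p) + norm (f' x - f' p)"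
        by (metis add.commute diff_add_cancel norm_triangle_ineq)
      then have "norm (f' x) \<le> B + 1" using B(2)[OF p(1)] \<open>dist (f' x) (f' p) < 1\<close>
        by (simp add: dist_norm)
      then show "onorm (blinfun_apply (f' x)) \<le> B + 1" by (simp add: norm_blinfun.rep_eq)
    qed (use p \<delta> in \<open>auto simp: dist_commute\<close>)
    then show "p' \<in> W \<and> norm (f p' - f p) \<le> (B + 1) * norm (p' - p)" using \<delta>(2) p by blast
  qed
qed

section \<open>Dependence of trajectories on parameter and initial point\<close>

text \<open>The hypothesis on \<open>z'\<close> is available only while \<open>z\<close> stays in the tube of radius \<open>\<delta>\<close>, and part of
  the claim is that \<open>z\<close> never leaves it. On any initial interval spent in the tube, the quantity
  \<open>(e\<^sup>2 + \<bar>z\<bar>\<^sup>2) exp (-3Ls)\<close> is nonincreasing; squares are used because \<open>\<bar>z\<bar>\<close> need not be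
  differentiable where \<open>z\<close> vanishes. The resulting bound is strictly below \<open>\<delta>\<^sup>2\<close>, so a first exit time from
  the tube would be contradictory.\<close>

lemma gronwall_in_tube:
  fixes z z' :: "real \<Rightarrow> 'a::real_inner"
  assumes der: "\<And>s. s \<in> {0..b} \<Longrightarrow> (z has_vector_derivative z' s) (at s within {0..b})"
    and bound: "\<And>s. s \<in> {0..b} \<Longrightarrow> norm (z s) < \<delta> \<Longrightarrow> norm (z' s) \<le> L * (e + norm (z s))"
    and "0 \<le> L" "0 < \<delta>"
    and small: "(e\<^sup>2 + (norm (z 0))\<^sup>2) * exp (3 * L * b) < \<delta>\<^sup>2"
    and s: "s \<in> {0..b}"
  shows "(norm (z s))\<^sup>2 \<le> (e\<^sup>2 + (norm (z 0))\<^sup>2) * exp (3 * L * b)"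
proof -
  define E where "E = (e\<^sup>2 + (norm (z 0))\<^sup>2) * exp (3 * L * b)"
  define \<phi> where "\<phi> s = (e\<^sup>2 + z s \<bullet> z s) * exp (- (3 * L * s))" for s
  have contz: "continuous_on {0..b} z"
    using der has_vector_derivative_continuous continuous_on_eq_continuous_within by blast
  \<comment> \<open>The bound holds up to any time before which the tube is not left.\<close>
  have upto: "(norm (z r))\<^sup>2 \<le> E"
    if r: "r \<in> {0..b}" and tube: "\<And>s. s \<in> {0<..<r} \<Longrightarrow> norm (z s) < \<delta>" for r
  proof -
    have "\<phi> r \<le> \<phi> 0"
    proof (rule DERIV_nonpos_imp_decreasing_open[where f = \<phi> and a = 0 and b = r])
      show "continuous_on {0..r} \<phi>"
        unfolding \<phi>_def using contz r
        by (intro continuous_intros) (auto elim!: continuous_on_subset)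
      fix s assume s: "0 < s" "s < r"
      then have "s \<in> interior {0..b}" using r by auto
      then have dz: "(z has_vector_derivative z' s) (at s)"
        using der[of s] s r at_within_interior[OF \<open>s \<in> interior {0..b}\<close>] by simp
      have "((\<lambda>s. z s \<bullet> z s) has_derivative (\<lambda>h. z s \<bullet> (h *\<^sub>R z' s) + (h *\<^sub>R z' s) \<bullet> z s)) (at s)"
        using dz unfolding has_vector_derivative_def by (intro has_derivative_inner)
      moreover have "(\<lambda>h. z s \<bullet> (h *\<^sub>R z' s) + (h *\<^sub>R z' s) \<bullet> z s) = (*) (2 * (z s \<bullet> z' s))"
        by (auto simp: inner_commute)
      ultimately have "((\<lambda>s. z s \<bullet> z s) has_real_derivative 2 * (z s \<bullet> z' s)) (at s)"
        unfolding has_field_derivative_def by (simp only:)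
      then have dq: "((\<lambda>s. e\<^sup>2 + z s \<bullet> z s) has_real_derivative 0 + 2 * (z s \<bullet> z' s)) (at s)"
        by (intro DERIV_add DERIV_const)
      have "((\<lambda>s. exp (- (3 * L * s))) has_real_derivative exp (- (3 * L * s)) * - (3 * L)) (at s)"
        by (auto intro!: derivative_eq_intros)
      from DERIV_mult[OF dq this]
      have D: "(\<phi> has_real_derivative
          (2 * (z s \<bullet> z' s) - 3 * L * (e\<^sup>2 + z s \<bullet> z s)) * exp (- (3 * L * s))) (at s)"
        by (simp add: \<phi>_def [abs_def] algebra_simps)
      let ?n = "norm (z s)"
      have "2 * (z s \<bullet> z' s) \<le> 2 * (?n * norm (z' s))"
        by (simp add: norm_cauchy_schwarz)
      also have "\<dots> \<le> 2 * (?n * (L * (e + ?n)))"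
        using bound[of s] tube[of s] s r by (intro mult_left_mono) auto
      also have "\<dots> = L * (2 * e * ?n + 2 * ?n\<^sup>2)" by (simp add: power2_eq_square algebra_simps)
      also have "\<dots> \<le> L * (3 * (e\<^sup>2 + ?n\<^sup>2))"
      proof (intro mult_left_mono \<open>0 \<le> L\<close>)
        have "2 * e * ?n \<le> e\<^sup>2 + ?n\<^sup>2" by (rule sum_squares_bound)
        then show "2 * e * ?n + 2 * ?n\<^sup>2 \<le> 3 * (e\<^sup>2 + ?n\<^sup>2)"
          using zero_le_power2[of e] unfolding distrib_left by linarith
      qed
      finally have "2 * (z s \<bullet> z' s) - 3 * L * (e\<^sup>2 + z s \<bullet> z s) \<le> 0"
        by (simp only: power2_norm_eq_inner mult_ac)
      then show "\<exists>y. (\<phi> has_real_derivative y) (at s) \<and> y \<le> 0"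
        using D mult_nonpos_nonneg[OF _ exp_ge_zero] by blast
    qed (use r in auto)
    then have "(e\<^sup>2 + (norm (z r))\<^sup>2) * exp (- (3 * L * r)) * exp (3 * L * r)
        \<le> (e\<^sup>2 + (norm (z 0))\<^sup>2) * exp (3 * L * r)"
      unfolding \<phi>_def by (intro mult_right_mono) (simp_all add: power2_norm_eq_inner)
    then have "e\<^sup>2 + (norm (z r))\<^sup>2 \<le> (e\<^sup>2 + (norm (z 0))\<^sup>2) * exp (3 * L * r)"
      by (simp add: mult.assoc flip: exp_add)
    also have "\<dots> \<le> E"
      unfolding E_def using r \<open>0 \<le> L\<close> by (intro mult_left_mono) (auto intro: mult_left_mono)
    finally show ?thesis using zero_le_power2[of e] by linarith
  qed
  \<comment> \<open>Continuity of \<open>z\<close> makes the set of bad times closed, so its infimum is a bad time itself.\<close>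
  have inside: "norm (z r) < \<delta>" if r: "r \<in> {0..b}" for r
  proof (rule ccontr)
    assume "\<not> norm (z r) < \<delta>"
    define A where "A = {s \<in> {0..b}. \<delta> \<le> norm (z s)}"
    have "A = {0..b} \<inter> (\<lambda>s. norm (z s)) -` {\<delta>..}" by (auto simp: A_def)
    then have "closed A"
      using continuous_closed_preimage[of "{0..b}" "\<lambda>s. norm (z s)" "{\<delta>..}"] contz
      by (auto intro: continuous_intros)
    moreover have "A \<noteq> {}" "bdd_below A" using r \<open>\<not> norm (z r) < \<delta>\<close> by (auto simp: A_def intro!: bdd_belowI[of _ 0])
    ultimately have inf: "Inf A \<in> A" using closed_contains_Inf by blast
    have "norm (z s) < \<delta>" if "s \<in> {0<..<Inf A}" for s
    proof (rule ccontr)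
      assume "\<not> norm (z s) < \<delta>"
      then have "s \<in> A" using that inf by (auto simp: A_def)
      then have "Inf A \<le> s" using \<open>bdd_below A\<close> by (simp add: cInf_lower)
      then show False using that by auto
    qed
    then have "(norm (z (Inf A)))\<^sup>2 \<le> E" using upto inf by (auto simp: A_def)
    moreover have "\<delta>\<^sup>2 \<le> (norm (z (Inf A)))\<^sup>2" using inf \<open>0 < \<delta>\<close> by (intro power_mono) (auto simp: A_def)
    ultimately show False using small by (simp add: E_def)
  qed
  show ?thesis using upto[OF s] inside s by (auto simp: E_def)
qed

lemma trajectory_continuous: "trajectory_on G D u I \<Longrightarrow> continuous_on I u"
  unfolding trajectory_on_def continuous_on_eq_continuous_within
  using has_vector_derivative_continuous by blast

lemma trajectory_shift:
  assumes "trajectory_on G D u I" "\<And>r. r \<in> I' \<Longrightarrow> s + r \<in> I"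
  shows "trajectory_on G D (\<lambda>r. u (s + r)) I'"
  unfolding trajectory_on_def
proof (intro ballI conjI)
  fix r assume r: "r \<in> I'"
  show "u (s + r) \<in> D" using assms r unfolding trajectory_on_def by blast
  have 1: "(u has_vector_derivative G (u (s + r))) (at (s + r) within (\<lambda>r. s + r) ` I')"
  proof (rule has_vector_derivative_within_subset)
    show "(u has_vector_derivative G (u (s + r))) (at (s + r) within I)"
      using assms r unfolding trajectory_on_def by blast
  qed (use assms(2) in auto)
  have "((\<lambda>r. s + r) has_vector_derivative 0 + 1) (at r within I')"
    by (intro has_vector_derivative_add has_vector_derivative_const has_vector_derivative_id)
  from vector_diff_chain_within[OF this 1]
  show "((\<lambda>r. u (s + r)) has_vector_derivative G (u (s + r))) (at r within I')"
    by (simp only: o_def scaleR_one add_0)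
qed

text \<open>The constants depend only on the reference trajectory \<open>u\<close>; the bound is quantitative so that
  \<open>\<epsilon> = 0\<close> with equal initial points gives uniqueness, and \<open>\<epsilon> \<rightarrow> 0\<close> gives uniform
  convergence. The field is compared as a map of the pair \<open>(\<epsilon>, x)\<close> near the compact curve
  \<open>{0} \<times> u ` {0..b}\<close>, which turns the parameter into the defect \<open>e\<close> of Gronwall's estimate.\<close>

lemma trajectory_dependence:
  fixes F :: "real \<Rightarrow> 'a::euclidean_space \<Rightarrow> 'a"
  assumes C1: "C1_map_on (\<lambda>(\<epsilon>, x). F \<epsilon> x) (J \<times> \<Omega>)" and "open J" "0 \<in> J" "open \<Omega>"
    and u: "trajectory_on (F 0) \<Omega> u {0..b}"
  obtains \<rho> C where "0 < \<rho>" "0 \<le> C"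
    "\<And>\<epsilon> w s. trajectory_on (F \<epsilon>) \<Omega> w {0..b} \<Longrightarrow> \<epsilon>\<^sup>2 + (norm (w 0 - u 0))\<^sup>2 < \<rho> \<Longrightarrow> s \<in> {0..b} \<Longrightarrow>
       (norm (w s - u s))\<^sup>2 \<le> C * (\<epsilon>\<^sup>2 + (norm (w 0 - u 0))\<^sup>2)"
proof -
  define K where "K = {0::real} \<times> u ` {0..b}"
  have "continuous_on {0..b} u" using u by (rule trajectory_continuous)
  then have "compact K" unfolding K_def by (intro compact_Times compact_continuous_image) auto
  have "K \<subseteq> J \<times> \<Omega>" using u \<open>0 \<in> J\<close> unfolding K_def trajectory_on_def by auto
  have "open (J \<times> \<Omega>)" using assms by (simp add: open_Times)
  obtain \<delta> L where \<delta>: "0 < \<delta>" "0 \<le> L" and lip: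
    "\<And>p p'. p \<in> K \<Longrightarrow> dist p' p < \<delta> \<Longrightarrow> p' \<in> J \<times> \<Omega> \<and>
        norm ((\<lambda>(\<epsilon>, x). F \<epsilon> x) p' - (\<lambda>(\<epsilon>, x). F \<epsilon> x) p) \<le> L * norm (p' - p)"
    using C1_lipschitz_near_compact[OF C1 \<open>open (J \<times> \<Omega>)\<close> \<open>compact K\<close> \<open>K \<subseteq> J \<times> \<Omega>\<close>] by metis
  define C where "C = exp (3 * L * b)"
  show thesis
  proof (rule that[of "min ((\<delta>/2)\<^sup>2) ((\<delta>/2)\<^sup>2 / C)" C])
    show "0 < min ((\<delta>/2)\<^sup>2) ((\<delta>/2)\<^sup>2 / C)" "0 \<le> C" using \<delta> by (auto simp: C_def)
    fix \<epsilon> w s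
    assume w: "trajectory_on (F \<epsilon>) \<Omega> w {0..b}"
      and small: "\<epsilon>\<^sup>2 + (norm (w 0 - u 0))\<^sup>2 < min ((\<delta>/2)\<^sup>2) ((\<delta>/2)\<^sup>2 / C)" and s: "s \<in> {0..b}"
    have "\<epsilon>\<^sup>2 < (\<delta>/2)\<^sup>2" using small zero_le_power2[of "norm (w 0 - u 0)"] by linarith
    then have e: "\<bar>\<epsilon>\<bar> < \<delta>/2" using \<delta> abs_le_square_iff[of "\<delta>/2" \<epsilon>] by auto
    have "(norm (w s - u s))\<^sup>2 \<le> (\<bar>\<epsilon>\<bar>\<^sup>2 + (norm (w 0 - u 0))\<^sup>2) * exp (3 * L * b)"
    proof (rule gronwall_in_tube[where \<delta> = "\<delta>/2" and z' = "\<lambda>s. F \<epsilon> (w s) - F 0 (u s)" and z = "\<lambda>s. w s - u s"])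
      fix s assume s: "s \<in> {0..b}"
      show "((\<lambda>s. w s - u s) has_vector_derivative F \<epsilon> (w s) - F 0 (u s)) (at s within {0..b})"
        using w u s unfolding trajectory_on_def by (intro has_vector_derivative_diff) auto
      assume ws: "norm (w s - u s) < \<delta>/2"
      have n: "norm ((\<epsilon>, w s) - (0, u s)) \<le> \<bar>\<epsilon>\<bar> + norm (w s - u s)"
        using norm_Pair_le[of \<epsilon> "w s - u s"] by simp
      then have "dist (\<epsilon>, w s) (0, u s) < \<delta>" using ws e by (simp add: dist_norm)
      then have "norm (F \<epsilon> (w s) - F 0 (u s)) \<le> L * norm ((\<epsilon>, w s) - (0, u s))"
        using lip[of "(0, u s)" "(\<epsilon>, w s)"] s by (auto simp: K_def)
      also have "\<dots> \<le> L * (\<bar>\<epsilon>\<bar> + norm (w s - u s))" using n \<delta> by (intro mult_left_mono)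
      finally show "norm (F \<epsilon> (w s) - F 0 (u s)) \<le> L * (\<bar>\<epsilon>\<bar> + norm (w s - u s))" .
    qed (use small s \<delta> in \<open>auto simp: C_def field_simps\<close>)
    then show "(norm (w s - u s))\<^sup>2 \<le> C * (\<epsilon>\<^sup>2 + (norm (w 0 - u 0))\<^sup>2)" by (simp add: C_def mult.commute)
  qed
qed

lemma trajectory_unique:
  fixes F :: "real \<Rightarrow> 'a::euclidean_space \<Rightarrow> 'a"
  assumes C1: "C1_map_on (\<lambda>(\<epsilon>, x). F \<epsilon> x) (J \<times> \<Omega>)" and "open J" "0 \<in> J" "open \<Omega>"
    and "trajectory_on (F 0) \<Omega> u {0..b}" "trajectory_on (F 0) \<Omega> w {0..b}" "u 0 = w 0"
    and "s \<in> {0..b}"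
  shows "w s = u s"
proof -
  obtain \<rho> C where *: "0 < \<rho>" "0 \<le> C"
    "\<And>\<epsilon> w s. trajectory_on (F \<epsilon>) \<Omega> w {0..b} \<Longrightarrow> \<epsilon>\<^sup>2 + (norm (w 0 - u 0))\<^sup>2 < \<rho> \<Longrightarrow> s \<in> {0..b} \<Longrightarrow>
       (norm (w s - u s))\<^sup>2 \<le> C * (\<epsilon>\<^sup>2 + (norm (w 0 - u 0))\<^sup>2)"
    using trajectory_dependence[OF assms(1-5)] by metis
  from *(3)[of 0 w s] *(1) assms show ?thesis by simp
qed

lemma exit_time_on_exit_surface:
  "exits_after G D R Sout x \<tau> \<Longrightarrow> x \<in> Sout \<Longrightarrow> \<tau> = 0"
  unfolding exits_after_def by force

section \<open>The transport equation for the remaining time\<close>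

text \<open>Along the trajectory from \<open>x\<close> the remaining time decreases at unit rate, because the trajectory
  that witnesses the exit time of an intermediate point must, by uniqueness, be the tail of the one
  from \<open>x\<close>, and both stop at their first visit to the exit surface. Differentiating at time 0
  with the chain rule gives \<open>F\<^sub>0 \<bullet> \<nabla>T = -1\<close>. Only the derivative from the right is available,
  since the exit time describes the future of \<open>x\<close>.\<close>

lemma timing_transport_equation:
  fixes F :: "real \<Rightarrow> 'a::euclidean_space \<Rightarrow> 'a"
  assumes C1: "C1_map_on (\<lambda>(\<epsilon>, x). F \<epsilon> x) (J \<times> \<Omega>)" "open J" "0 \<in> J" "open \<Omega>"
    and R: "open R" "Sout \<subseteq> frontier R"
    and timing: "local_timing_response (F 0) \<Omega> R Sin Sout U T \<eta>" and "open U"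
    and x: "x \<in> U" "x \<in> R"
  shows "\<eta> x \<bullet> F 0 x = -1"
proof -
  define \<tau> where "\<tau> = T x"
  have exits: "exits_after (F 0) \<Omega> R Sout y (T y)" if "y \<in> U" "y \<in> R" for y
    using timing that unfolding local_timing_response_def by auto
  obtain u where u: "0 \<le> \<tau>" "trajectory_on (F 0) \<Omega> u {0..\<tau>}" "u 0 = x" "u \<tau> \<in> Sout"
      "\<And>s. s \<in> {0..<\<tau>} \<Longrightarrow> u s \<notin> Sout" "\<And>s. s \<in> {0<..<\<tau>} \<Longrightarrow> u s \<in> R"
    using exits[OF x] unfolding exits_after_def \<tau>_def by auto
  have "x \<notin> Sout" using x R by (auto simp: frontier_def interior_open)
  with u have "0 < \<tau>" by (cases "\<tau> = 0") auto
  have remaining: "T (u s) = \<tau> - s" if s: "0 \<le> s" "s < \<tau>" "u s \<in> U" for s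
  proof -
    have "u s \<in> R" using u x s by (cases "s = 0") auto
    from exits[OF s(3) this] obtain w where
      w: "0 \<le> T (u s)" "trajectory_on (F 0) \<Omega> w {0..T (u s)}" "w 0 = u s" "w (T (u s)) \<in> Sout"
        "\<And>r. r \<in> {0..<T (u s)} \<Longrightarrow> w r \<notin> Sout"
      unfolding exits_after_def by auto
    \<comment> \<open>If the two exit times differed, the trajectory with the later one would be on the exit surface
      at time \<open>m\<close>, before its first visit there.\<close>
    define m where "m = min (\<tau> - s) (T (u s))"
    have "trajectory_on (F 0) \<Omega> (\<lambda>r. u (s + r)) {0..m}"
      using s by (intro trajectory_shift[OF u(2)]) (auto simp: m_def)
    moreover have "trajectory_on (F 0) \<Omega> w {0..m}"
      using trajectory_shift[OF w(2), of "{0..m}" 0] by (simp add: m_def)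
    ultimately have "w m = u (s + m)"
      using trajectory_unique[OF C1, of "\<lambda>r. u (s + r)" m w m] w s by (auto simp: m_def)
    then show ?thesis
      using u(4) u(5)[of "s + m"] w(1,4) w(5)[of m] s
      by (cases "T (u s)" "\<tau> - s" rule: linorder_cases) (auto simp: m_def)
  qed
  have x0: "at 0 within {0..\<tau>} \<noteq> bot"
    using \<open>0 < \<tau>\<close> by (simp add: trivial_limit_within islimpt_Icc)
  have du: "(u has_vector_derivative F 0 x) (at 0 within {0..\<tau>})"
    using u unfolding trajectory_on_def by force
  have dT: "(T has_derivative (\<lambda>h. h \<bullet> \<eta> x)) (at x)"
    using timing x unfolding local_timing_response_def gderiv_def by blast
  have dTu: "(T has_derivative (\<lambda>h. h \<bullet> \<eta> x)) (at (u 0) within u ` {0..\<tau>})"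
    using dT u(3) has_derivative_at_withinI by blast
  then have "((\<lambda>s. T (u s)) has_vector_derivative \<eta> x \<bullet> F 0 x) (at 0 within {0..\<tau>})"
    using vector_derivative_diff_chain_within[OF du dTu] by (simp add: o_def inner_commute)
  moreover have "((\<lambda>s. T (u s)) has_vector_derivative -1) (at 0 within {0..\<tau>})"
  proof -
    have "(u \<longlongrightarrow> x) (at 0 within {0..\<tau>})"
      using has_vector_derivative_continuous[OF du] u(3) by (simp add: continuous_within)
    then have 1: "\<forall>\<^sub>F s in at 0 within {0..\<tau>}. u s \<in> U"
      using topological_tendstoD[OF _ \<open>open U\<close> x(1)] by blast
    have 2: "\<forall>\<^sub>F s in at 0 within {0..\<tau>}. s < \<tau>"
      using \<open>0 < \<tau>\<close> by (intro order_tendstoD(2)[OF tendsto_ident_at])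
    have 3: "\<forall>\<^sub>F s in at 0 within {0..\<tau>}. 0 \<le> s"
      by (auto simp: eventually_at_filter)
    have ev: "\<forall>\<^sub>F s in at 0 within {0..\<tau>}. \<tau> - s = T (u s)"
      using 1 2 3 by eventually_elim (simp add: remaining)
    have "((\<lambda>s. \<tau> - s) has_vector_derivative -1) (at 0 within {0..\<tau>})"
      by (auto intro!: derivative_eq_intros)
    from has_derivative_transform_eventually[OF this[unfolded has_vector_derivative_def] ev]
    show ?thesis
      using remaining[of 0] \<open>0 < \<tau>\<close> u(3) x(1) by (simp add: has_vector_derivative_def)
  qed
  ultimately show ?thesis using vector_derivative_unique_within[OF x0] by blast
qed

section \<open>First variation of the transit time\<close>

text \<open>The analytic core. Here \<open>S \<epsilon>\<close> is the transit time of \<open>v \<epsilon>\<close> and \<open>T\<close> the unperturbed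
  remaining time; mere continuity of \<open>S\<close> at 0 already forces differentiability. By the transport
  equation, \<open>T\<close> changes along \<open>v \<epsilon>\<close> at rate \<open>-1 + \<eta> \<bullet> (F \<epsilon> - F 0)\<close>, and its total change from
  entry to exit is \<open>- T (v \<epsilon> 0)\<close>. With \<open>a\<close> the integrand of the claim and \<open>A\<close> its
  antiderivative, this reads \<open>S \<epsilon> = T (v \<epsilon> 0) + \<epsilon> A (S \<epsilon>) + o(\<epsilon>)\<close>, and each term can be
  differentiated at 0. The interval \<open>{0..b}\<close> reaches beyond \<open>S 0\<close> so that it covers the
  transit of \<open>v \<epsilon>\<close> also when that takes longer.\<close>

lemma transit_time_derivative:
  fixes F :: "real \<Rightarrow> 'a::euclidean_space \<Rightarrow> 'a"
    and v :: "real \<Rightarrow> real \<Rightarrow> 'a" and T :: "'a \<Rightarrow> real" and S :: "real \<Rightarrow> real"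
  assumes C1: "C1_map_on (\<lambda>(\<epsilon>, x). F \<epsilon> x) (J \<times> \<Omega>)" "open J" "0 \<in> J" "open \<Omega>"
    and U: "open U" "U \<subseteq> \<Omega>"
    and traj: "\<And>\<epsilon>. \<epsilon> \<in> J \<Longrightarrow> trajectory_on (F \<epsilon>) \<Omega> (v \<epsilon>) {0..b}"
    and inU: "v 0 ` {0..b} \<subseteq> U"
    and T: "\<And>x. x \<in> U \<Longrightarrow> GDERIV T x :> \<eta> x" "continuous_on U \<eta>"
    and S: "isCont S 0" "0 < S 0" "S 0 < b" "\<And>\<epsilon>. \<epsilon> \<in> J \<Longrightarrow> 0 < S \<epsilon>"
    and transport: "\<And>\<epsilon> s. \<epsilon> \<in> J \<Longrightarrow> 0 < s \<Longrightarrow> s < S \<epsilon> \<Longrightarrow> v \<epsilon> s \<in> U \<Longrightarrow>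
      \<eta> (v \<epsilon> s) \<bullet> F 0 (v \<epsilon> s) = -1"
    and exit: "\<And>\<epsilon>. \<epsilon> \<in> J \<Longrightarrow> v \<epsilon> (S \<epsilon>) \<in> U \<Longrightarrow> T (v \<epsilon> (S \<epsilon>)) = 0"
    and start: "((\<lambda>\<epsilon>. v \<epsilon> 0) has_vector_derivative X) (at 0)"
  shows "(S has_real_derivative \<eta> (v 0 0) \<bullet> X
      + integral {0..S 0} (\<lambda>s. \<eta> (v 0 s) \<bullet> vector_derivative (\<lambda>\<epsilon>. F \<epsilon> (v 0 s)) (at 0))) (at 0)"
proof -
  obtain F' where
    F': "\<And>p. p \<in> J \<times> \<Omega> \<Longrightarrow> ((\<lambda>(\<epsilon>, x). F \<epsilon> x) has_derivative blinfun_apply (F' p)) (at p)"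
    and contF': "continuous_on (J \<times> \<Omega>) F'"
    using C1(1) unfolding C1_map_on_def by blast
  define D where "D p = blinfun_apply (F' p) (1, 0)" for p
  have contD: "continuous_on (J \<times> \<Omega>) D"
    unfolding D_def by (intro bounded_bilinear.continuous_on[OF bounded_bilinear_blinfun_apply] contF' continuous_on_const)
  have dF: "((\<lambda>e. F e y) has_vector_derivative D (e, y)) (at e)" if "e \<in> J" "y \<in> \<Omega>" for e y
  proof -
    have 1: "((\<lambda>e. (e, y)) has_vector_derivative (1, 0)) (at e)"
      by (intro has_vector_derivative_Pair has_vector_derivative_id has_vector_derivative_const)
    have 2: "((\<lambda>(\<epsilon>, x). F \<epsilon> x) has_derivative blinfun_apply (F' (e, y)))
        (at ((\<lambda>e. (e, y)) e) within range (\<lambda>e. (e, y)))"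
      using has_derivative_at_withinI[OF F'[of "(e, y)"]] that by blast
    show ?thesis
      using vector_derivative_diff_chain_within[OF 1 2] by (simp add: o_def D_def)
  qed
  have D0: "vector_derivative (\<lambda>e. F e y) (at 0) = D (0, y)" if "y \<in> U" for y
    using dF[of 0 y] C1(3) U(2) that vector_derivative_at by blast
  have cont_v: "continuous_on {0..b} (v 0)"
    using trajectory_continuous traj C1(3) by blast
  \<comment> \<open>The integrand as a function of parameter and position, to be compared with its value on the
    unperturbed orbit.\<close>
  define q where "q p = \<eta> (snd p) \<bullet> D p" for p
  have contq: "continuous_on (J \<times> U) q"
    unfolding q_def using U(2)
    by (intro continuous_on_inner continuous_on_compose2[OF T(2)] continuous_on_snd
        continuous_on_id continuous_on_subset[OF contD]) auto
  define a where "a s = q (0, v 0 s)" for s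
  have conta: "continuous_on {0..b} a"
    unfolding a_def using inU C1(3)
    by (intro continuous_on_compose2[OF contq] continuous_on_Pair continuous_on_const cont_v) auto
  define A where "A s = integral {0..s} a" for s
  have dA: "(A has_real_derivative a s) (at s within {0..b})" if "s \<in> {0..b}" for s
    unfolding A_def using integral_has_real_derivative[OF conta that] .

  obtain \<rho> C where \<rho>: "0 < \<rho>" "0 \<le> C" and close:
    "\<And>\<epsilon> w s. trajectory_on (F \<epsilon>) \<Omega> w {0..b} \<Longrightarrow> \<epsilon>\<^sup>2 + (norm (w 0 - v 0 0))\<^sup>2 < \<rho> \<Longrightarrow>
       s \<in> {0..b} \<Longrightarrow> (norm (w s - v 0 s))\<^sup>2 \<le> C * (\<epsilon>\<^sup>2 + (norm (w 0 - v 0 0))\<^sup>2)"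
    using trajectory_dependence[OF C1 traj[OF C1(3)]] by metis
  have start0: "((\<lambda>\<epsilon>. v \<epsilon> 0) \<longlongrightarrow> v 0 0) (nhds 0)"
    using has_vector_derivative_continuous[OF start] by (simp add: continuous_at tendsto_nhds_iff)
  then have gap: "((\<lambda>\<epsilon>. \<epsilon>\<^sup>2 + (norm (v \<epsilon> 0 - v 0 0))\<^sup>2) \<longlongrightarrow> 0) (nhds 0)"
    by (auto intro!: tendsto_eq_intros filterlim_ident)
  have uniform: "\<forall>\<^sub>F \<epsilon> in nhds 0. \<forall>s\<in>{0..b}. norm (v \<epsilon> s - v 0 s) < \<delta>" if "0 < \<delta>" for \<delta>
  proof -
    have "0 < min \<rho> (\<delta>\<^sup>2 / (C + 1))" using \<rho> that by simp
    then have "\<forall>\<^sub>F \<epsilon> in nhds 0. \<epsilon>\<^sup>2 + (norm (v \<epsilon> 0 - v 0 0))\<^sup>2 < min \<rho> (\<delta>\<^sup>2 / (C + 1))"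
      using order_tendstoD(2)[OF gap] by blast
    moreover have "\<forall>\<^sub>F \<epsilon> in nhds 0. \<epsilon> \<in> J" using C1(2,3) eventually_nhds_in_open by blast
    ultimately show ?thesis
    proof eventually_elim
      case (elim \<epsilon>)
      show ?case
      proof
        fix s assume s: "s \<in> {0..b}"
        let ?g = "\<epsilon>\<^sup>2 + (norm (v \<epsilon> 0 - v 0 0))\<^sup>2"
        have "0 \<le> ?g" by simp
        have "(norm (v \<epsilon> s - v 0 s))\<^sup>2 \<le> C * ?g"
          using close[OF traj[OF elim(2)] _ s] elim(1) by simp
        also have "\<dots> \<le> (C + 1) * ?g" using \<open>0 \<le> ?g\<close> by (intro mult_right_mono) auto
        also have "\<dots> < \<delta>\<^sup>2" using elim(1) \<rho> by (simp add: pos_less_divide_eq mult.commute)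
        finally show "norm (v \<epsilon> s - v 0 s) < \<delta>" using that by (simp add: power_less_imp_less_base)
      qed
    qed
  qed

  \<comment> \<open>The error term of the expansion, shown to be \<open>o(\<epsilon>)\<close>.\<close>
  define r where "r \<epsilon> = S \<epsilon> - T (v \<epsilon> 0) - \<epsilon> * A (S \<epsilon>)" for \<epsilon>
  have small: "\<forall>\<^sub>F \<epsilon> in nhds 0. \<bar>r \<epsilon>\<bar> \<le> \<kappa> * b * \<bar>\<epsilon>\<bar>" if \<kappa>: "0 < \<kappa>" for \<kappa>
  proof -
    define K where "K = {0::real} \<times> v 0 ` {0..b}"
    have K: "open (J \<times> U)" "compact K" "K \<subseteq> J \<times> U"
      using C1(2,3) U(1) inU cont_v unfolding K_def
      by (auto intro!: open_Times compact_Times compact_continuous_image)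
    obtain \<delta> where \<delta>: "0 < \<delta>" and near: "\<And>p p'. p \<in> K \<Longrightarrow> dist p' p < \<delta> \<Longrightarrow>
        p' \<in> J \<times> U \<and> dist (q p') (q p) < \<kappa>"
      using uniformly_continuous_near_compact[OF K contq \<kappa>] by blast
    have "\<forall>\<^sub>F \<epsilon> in nhds 0. S \<epsilon> < b"
      using S(1,3) order_tendstoD(2)[of S "S 0" "nhds 0" b]
      by (simp add: continuous_at tendsto_nhds_iff)
    moreover have "\<forall>\<^sub>F \<epsilon> in nhds (0::real). \<epsilon> \<in> ball 0 (\<delta>/2)"
      using \<delta> by (intro eventually_nhds_in_open) auto
    moreover have "\<forall>\<^sub>F \<epsilon> in nhds 0. \<forall>s\<in>{0..b}. norm (v \<epsilon> s - v 0 s) < \<delta>/2"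
      using \<delta> by (intro uniform) auto
    ultimately show ?thesis
    proof eventually_elim
      case (elim \<epsilon>)
      have tube: "(e, v \<epsilon> s) \<in> J \<times> U \<and> \<bar>q (e, v \<epsilon> s) - a s\<bar> < \<kappa>"
        if "e \<in> ball 0 (\<delta>/2)" "s \<in> {0..b}" for e s
      proof -
        have "norm ((e, v \<epsilon> s) - (0, v 0 s)) \<le> \<bar>e\<bar> + norm (v \<epsilon> s - v 0 s)"
          using norm_Pair_le[of e "v \<epsilon> s - v 0 s"] by simp
        also have "\<dots> < \<delta>" using elim(3) that by fastforce
        finally show ?thesis
          using near[of "(0, v 0 s)" "(e, v \<epsilon> s)"] that(2) by (simp add: K_def a_def dist_norm)
      qed
      have \<epsilon>: "\<epsilon> \<in> J" "0 < S \<epsilon>" using tube[OF elim(2), of 0] S by auto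
      have vU: "v \<epsilon> s \<in> U" if "s \<in> {0..b}" for s using tube[OF elim(2) that] by simp
      \<comment> \<open>Remaining plus elapsed time, corrected by the predicted drift: nearly constant along the orbit.\<close>
      define h where "h s = T (v \<epsilon> s) + s - \<epsilon> * A s" for s
      define h' where "h' s = \<eta> (v \<epsilon> s) \<bullet> F \<epsilon> (v \<epsilon> s) + 1 - \<epsilon> * a s" for s
      have dh: "(h has_real_derivative h' s) (at s within {0..b})" if s: "s \<in> {0..b}" for s
      proof -
        have 1: "(v \<epsilon> has_vector_derivative F \<epsilon> (v \<epsilon> s)) (at s within {0..b})"
          using traj[OF \<epsilon>(1)] s unfolding trajectory_on_def by blast
        have 2: "(T has_derivative (\<lambda>h. h \<bullet> \<eta> (v \<epsilon> s))) (at (v \<epsilon> s) within v \<epsilon> ` {0..b})"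
          using T(1)[OF vU[OF s]] has_derivative_at_withinI unfolding gderiv_def by blast
        have "((\<lambda>s. T (v \<epsilon> s)) has_real_derivative \<eta> (v \<epsilon> s) \<bullet> F \<epsilon> (v \<epsilon> s)) (at s within {0..b})"
          using vector_derivative_diff_chain_within[OF 1 2]
          by (simp add: o_def inner_commute has_real_derivative_iff_has_vector_derivative)
        then show ?thesis
          unfolding h_def h'_def by (intro DERIV_diff DERIV_add DERIV_ident DERIV_cmult dA[OF s])
      qed
      have h'_bound: "\<bar>h' s\<bar> \<le> \<kappa> * \<bar>\<epsilon>\<bar>" if s: "0 < s" "s < S \<epsilon>" for s
      proof -
        have sb: "s \<in> {0..b}" using s elim(1) by auto
        let ?y = "v \<epsilon> s"
        let ?f = "\<lambda>e. \<eta> ?y \<bullet> F e ?y - e * a s"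
        \<comment> \<open>Mean value inequality in the parameter alone, at a fixed position.\<close>
        have "norm (?f \<epsilon> - ?f 0) \<le> \<kappa> * norm (\<epsilon> - 0)"
        proof (rule field_differentiable_bound[where S = "ball 0 (\<delta>/2)" and f' = "\<lambda>e. q (e, ?y) - a s"])
          fix e :: real assume e: "e \<in> ball 0 (\<delta>/2)"
          then have "e \<in> J" "?y \<in> \<Omega>" using tube[OF e sb] U(2) by auto
          then have "((\<lambda>e. F e ?y) has_derivative (\<lambda>h. h *\<^sub>R D (e, ?y))) (at e within ball 0 (\<delta>/2))"
            using dF has_derivative_at_withinI unfolding has_vector_derivative_def by blast
          from has_derivative_inner_right[OF this, of "\<eta> ?y"]
          have "((\<lambda>e. \<eta> ?y \<bullet> F e ?y) has_real_derivative q (e, ?y)) (at e within ball 0 (\<delta>/2))"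
            by (simp add: has_field_derivative_def q_def mult_commute_abs)
          moreover have "((\<lambda>e. e * a s) has_real_derivative a s) (at e within ball 0 (\<delta>/2))"
            by (auto intro!: derivative_eq_intros)
          ultimately show "(?f has_real_derivative q (e, ?y) - a s) (at e within ball 0 (\<delta>/2))"
            by (rule DERIV_diff)
          show "norm (q (e, ?y) - a s) \<le> \<kappa>" using tube[OF e sb] by simp
        qed (use \<delta> elim(2) in auto)
        moreover have "h' s = ?f \<epsilon> - ?f 0"
          using transport[OF \<epsilon>(1) s vU[OF sb]] by (simp add: h'_def)
        ultimately show ?thesis by simp
      qed
      have "\<exists>\<xi>\<in>{0<..<S \<epsilon>}. h (S \<epsilon>) - h 0 = h' \<xi> * (S \<epsilon> - 0)"
      proof (rule mvt[OF \<epsilon>(2)])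
        have "continuous_on {0..b} h" using dh DERIV_continuous continuous_on_eq_continuous_within by blast
        then show "continuous_on {0..S \<epsilon>} h" using elim(1) by (auto elim: continuous_on_subset)
        fix s assume s: "0 < s" "s < S \<epsilon>"
        then have "s \<in> interior {0..b}" "s \<in> {0..b}" using elim(1) by auto
        then have "(h has_real_derivative h' s) (at s)"
          using dh[of s] at_within_interior[of s "{0..b}"] by metis
        then show "(h has_derivative (*) (h' s)) (at s)" by (simp add: has_field_derivative_def)
      qed auto
      then obtain \<xi> where \<xi>: "0 < \<xi>" "\<xi> < S \<epsilon>" "h (S \<epsilon>) - h 0 = h' \<xi> * S \<epsilon>" by auto
      have "A 0 = 0" by (simp add: A_def)
      then have "r \<epsilon> = h (S \<epsilon>) - h 0"
        using exit[OF \<epsilon>(1) vU[of "S \<epsilon>"]] \<epsilon> elim(1) by (simp add: r_def h_def)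
      then have "\<bar>r \<epsilon>\<bar> = \<bar>h' \<xi>\<bar> * S \<epsilon>" using \<xi>(3) \<epsilon>(2) by (simp add: abs_mult)
      also have "\<dots> \<le> (\<kappa> * \<bar>\<epsilon>\<bar>) * b"
        using h'_bound[OF \<xi>(1,2)] \<epsilon>(2) elim(1) \<kappa> by (intro mult_mono) auto
      finally show ?case by (simp only: mult_ac)
    qed
  qed
  have b: "0 < b" using S by simp
  have r0: "r 0 = 0" using eventually_nhds_x_imp_x[OF small[OF zero_less_one]] by simp
  have dr: "(r has_real_derivative 0) (at 0)"
    unfolding DERIV_def
  proof (rule tendstoI)
    fix e :: real assume "0 < e"
    then have "\<forall>\<^sub>F \<epsilon> in nhds 0. \<bar>r \<epsilon>\<bar> \<le> e / (2 * b) * b * \<bar>\<epsilon>\<bar>" using b by (intro small) simp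
    then have "\<forall>\<^sub>F \<epsilon> in at 0. \<bar>r \<epsilon>\<bar> \<le> e / 2 * \<bar>\<epsilon>\<bar> \<and> \<epsilon> \<noteq> 0"
      using b by (auto simp: eventually_at_filter elim!: eventually_mono)
    then show "\<forall>\<^sub>F \<epsilon> in at 0. dist ((r (0 + \<epsilon>) - r 0) / \<epsilon>) 0 < e"
    proof eventually_elim
      case (elim \<epsilon>)
      then have "\<bar>r \<epsilon>\<bar> < e * \<bar>\<epsilon>\<bar>" using \<open>0 < e\<close> by (smt (verit) field_sum_of_halves mult_pos_pos distrib_right)
      then show ?case using elim r0 by (simp add: pos_divide_less_eq)
    qed
  qed
  have dT: "((\<lambda>\<epsilon>. T (v \<epsilon> 0)) has_real_derivative \<eta> (v 0 0) \<bullet> X) (at 0)"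
  proof -
    have "v 0 0 \<in> U" using inU b by auto
    then have 2: "(T has_derivative (\<lambda>h. h \<bullet> \<eta> (v 0 0))) (at (v 0 0) within range (\<lambda>\<epsilon>. v \<epsilon> 0))"
      using T(1) has_derivative_at_withinI unfolding gderiv_def by blast
    show ?thesis
      using vector_derivative_diff_chain_within[OF start 2]
      by (simp add: o_def inner_commute has_real_derivative_iff_has_vector_derivative)
  qed
  have dAS: "((\<lambda>\<epsilon>. \<epsilon> * A (S \<epsilon>)) has_real_derivative A (S 0)) (at 0)"
  proof -
    have s: "S 0 \<in> interior {0..b}" "S 0 \<in> {0..b}" using S by auto
    have "isCont A (S 0)"
      using DERIV_continuous[OF dA[OF s(2)]] at_within_interior[OF s(1)] by simp
    then have "isCont (\<lambda>\<epsilon>. A (S \<epsilon>)) 0" using isCont_o2[OF S(1)] by blast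
    \<comment> \<open>Caratheodory's criterion: the factor \<open>A (S \<epsilon>)\<close> need only be continuous at 0.\<close>
    then show ?thesis unfolding CARAT_DERIV by (intro exI[of _ "\<lambda>\<epsilon>. A (S \<epsilon>)"]) auto
  qed
  have "((\<lambda>\<epsilon>. r \<epsilon> + T (v \<epsilon> 0) + \<epsilon> * A (S \<epsilon>)) has_real_derivative 0 + \<eta> (v 0 0) \<bullet> X + A (S 0)) (at 0)"
    by (intro DERIV_add dr dT dAS)
  moreover have "(\<lambda>\<epsilon>. r \<epsilon> + T (v \<epsilon> 0) + \<epsilon> * A (S \<epsilon>)) = S" by (auto simp: r_def)
  moreover have "A (S 0) = integral {0..S 0} (\<lambda>s. \<eta> (v 0 s) \<bullet> vector_derivative (\<lambda>\<epsilon>. F \<epsilon> (v 0 s)) (at 0))"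
    unfolding A_def
  proof (rule integral_cong)
    fix s assume "s \<in> {0..S 0}"
    then have "v 0 s \<in> U" using inU S by auto
    then show "a s = \<eta> (v 0 s) \<bullet> vector_derivative (\<lambda>\<epsilon>. F \<epsilon> (v 0 s)) (at 0)"
      by (simp add: a_def q_def D0)
  qed
  ultimately show ?thesis by simp
qed

section \<open>The local timing response formula\<close>

lemma first_order_expansion_derivative:
  assumes "first_order_expansion f c"
  shows "(f has_vector_derivative c) (at 0)"
proof -
  obtain K where "\<forall>\<^sub>F \<epsilon> in at 0. norm (norm (f \<epsilon> - f 0 - \<epsilon> *\<^sub>R c)) \<le> K * norm (\<epsilon>\<^sup>2)"
    using assms landau_o.bigE unfolding first_order_expansion_def by blast
  then have "\<forall>\<^sub>F \<epsilon> in at 0. norm (norm (f \<epsilon> - f 0 - \<epsilon> *\<^sub>R c) / norm \<epsilon>) \<le> norm \<epsilon> * K"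
  proof eventually_elim
    case (elim \<epsilon>)
    have sq: "norm (\<epsilon>\<^sup>2) = \<bar>\<epsilon>\<bar> * \<bar>\<epsilon>\<bar>" by (simp add: power2_eq_square abs_mult)
    have "norm (f \<epsilon> - f 0 - \<epsilon> *\<^sub>R c) \<le> (\<bar>\<epsilon>\<bar> * K) * \<bar>\<epsilon>\<bar>"
      using elim unfolding sq by (simp only: real_norm_def abs_norm_cancel mult_ac)
    then show ?case by (cases "\<epsilon> = 0") (simp_all add: pos_divide_le_eq)
  qed
  then have "((\<lambda>\<epsilon>. norm (f \<epsilon> - f 0 - \<epsilon> *\<^sub>R c) / norm \<epsilon>) \<longlongrightarrow> 0) (at 0)"
    by (rule tendsto_0_le[OF tendsto_ident_at])
  then show ?thesis
    unfolding has_vector_derivative_def has_derivative_at by (simp add: bounded_linear_scaleR_left)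
qed

text \<open>It remains to place the limit cycles in the setting above, with clocks reset at entry: \<open>v \<epsilon>\<close> is
  \<open>\<gamma> \<epsilon>\<close> started at time \<open>tin \<epsilon>\<close>.\<close>

theorem mainTheorem3:
  fixes F :: "real \<Rightarrow> real^'n \<Rightarrow> real^'n"
    and \<Omega> R \<Sigma>in \<Sigma>out U :: "(real^'n) set"
    and J :: "real set"
    and \<gamma> :: "real \<Rightarrow> real \<Rightarrow> real^'n"
    and P tin tout TI :: "real \<Rightarrow> real"
    and xin :: "real \<Rightarrow> real^'n"
    and \<T> :: "real \<Rightarrow> real^'n \<Rightarrow> real"
    and \<eta> :: "real \<Rightarrow> real^'n \<Rightarrow> real^'n"
    and TI1 :: real
  assumes "open \<Omega>" and "open J" and "0 \<in> J"
    and F_C1: "C1_map_on (\<lambda>(\<epsilon>, x). F \<epsilon> x) (J \<times> \<Omega>)"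
    and F_expansion: "\<forall>x\<in>\<Omega>. first_order_expansion (\<lambda>\<epsilon>. F \<epsilon> x)
                        (vector_derivative (\<lambda>\<epsilon>. F \<epsilon> x) (at 0))"
    and limit_cycles: "\<forall>\<epsilon>\<in>J. stable_limit_cycle (F \<epsilon>) \<Omega> (\<gamma> \<epsilon>) (P \<epsilon>)"
    and period_C1: "P C1_differentiable_on J"
    and cycles_close: "\<exists>\<sigma> C. (\<forall>\<epsilon>\<in>J. strict_mono (\<sigma> \<epsilon>) \<and> surj (\<sigma> \<epsilon>)) \<and>
                        (\<forall>\<^sub>F \<epsilon> in at 0. \<forall>t::real. norm (\<gamma> \<epsilon> (\<sigma> \<epsilon> t) - \<gamma> 0 t) \<le> C * \<bar>\<epsilon>\<bar>)"
    and region: "open R" "connected R" "R \<subseteq> \<Omega>"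
    and boundary: "\<Sigma>in \<subseteq> \<Omega> \<inter> frontier R" "\<Sigma>out \<subseteq> \<Omega> \<inter> frontier R"
    and surfaces: "C1_hypersurface \<Sigma>in" "C1_hypersurface \<Sigma>out"
    and transversality: "transverse_to \<Sigma>in (F 0) (\<gamma> 0)" "transverse_to \<Sigma>out (F 0) (\<gamma> 0)"
    and passage: "\<forall>\<epsilon>\<in>J. passes_through R \<Sigma>in \<Sigma>out (\<gamma> \<epsilon>) (tin \<epsilon>) (tout \<epsilon>)"
    and entry_point: "\<forall>\<epsilon>\<in>J. xin \<epsilon> = \<gamma> \<epsilon> (tin \<epsilon>)"
    and entry_expansion: "first_order_expansion xin (vector_derivative xin (at 0))"
    and time_in_region: "\<forall>\<epsilon>\<in>J. TI \<epsilon> = tout \<epsilon> - tin \<epsilon>"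
    and time_expansion: "first_order_expansion TI TI1"
    and nbhd: "open U" "\<gamma> 0 ` {tin 0..tout 0} \<subseteq> U" "U \<subseteq> \<Omega>"
    and timing: "\<forall>\<epsilon>\<in>J. local_timing_response (F \<epsilon>) \<Omega> R \<Sigma>in \<Sigma>out U (\<T> \<epsilon>) (\<eta> \<epsilon>)"
    and timing_expansion: "\<forall>x \<in> U \<inter> (R \<union> \<Sigma>in \<union> \<Sigma>out).
                        (\<exists>c. first_order_expansion (\<lambda>\<epsilon>. \<T> \<epsilon> x) c) \<and>
                        (\<exists>c. first_order_expansion (\<lambda>\<epsilon>. \<eta> \<epsilon> x) c)"
  shows "TI1 = \<eta> 0 (xin 0) \<bullet> vector_derivative xin (at 0)
           + integral {tin 0..tout 0}
               (\<lambda>t. \<eta> 0 (\<gamma> 0 t) \<bullet> vector_derivative (\<lambda>\<epsilon>. F \<epsilon> (\<gamma> 0 t)) (at 0))"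
proof -
  have T0: "local_timing_response (F 0) \<Omega> R \<Sigma>in \<Sigma>out U (\<T> 0) (\<eta> 0)"
    using timing \<open>0 \<in> J\<close> by blast
  have orbit: "trajectory_on (F \<epsilon>) \<Omega> (\<gamma> \<epsilon>) UNIV" if "\<epsilon> \<in> J" for \<epsilon>
    using limit_cycles that unfolding stable_limit_cycle_def periodic_orbit_def by blast
  have pass: "tin \<epsilon> < tout \<epsilon>" "\<gamma> \<epsilon> (tout \<epsilon>) \<in> \<Sigma>out" "\<And>t. tin \<epsilon> < t \<Longrightarrow> t < tout \<epsilon> \<Longrightarrow> \<gamma> \<epsilon> t \<in> R"
    if "\<epsilon> \<in> J" for \<epsilon>
    using passage that unfolding passes_through_def by auto
  define v where "v \<epsilon> s = \<gamma> \<epsilon> (tin \<epsilon> + s)" for \<epsilon> s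
  have TI: "TI \<epsilon> = tout \<epsilon> - tin \<epsilon>" "0 < TI \<epsilon>" if "\<epsilon> \<in> J" for \<epsilon>
    using time_in_region pass that by auto

  have "continuous_on UNIV (\<gamma> 0)" using trajectory_continuous orbit \<open>0 \<in> J\<close> by blast
  then have "open (\<gamma> 0 -` U)" using \<open>open U\<close> open_vimage by blast
  moreover have "tout 0 \<in> \<gamma> 0 -` U" using nbhd(2) pass(1)[OF \<open>0 \<in> J\<close>] by auto
  \<comment> \<open>Since \<open>U\<close> is open, the orbit stays in it for some time \<open>d\<close> after the exit.\<close>
  ultimately obtain d where d: "0 < d" "cball (tout 0) d \<subseteq> \<gamma> 0 -` U"
    using open_contains_cball by blast
  define b where "b = TI 0 + d"
  have inU: "v 0 ` {0..b} \<subseteq> U"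
  proof
    fix y assume "y \<in> v 0 ` {0..b}"
    then obtain s where s: "y = \<gamma> 0 (tin 0 + s)" "0 \<le> s" "s \<le> b" by (auto simp: v_def)
    show "y \<in> U"
    proof (cases "tin 0 + s \<le> tout 0")
      case True
      then show ?thesis using s nbhd(2) by auto
    next
      case False
      then have "tin 0 + s \<in> cball (tout 0) d"
        using s TI[OF \<open>0 \<in> J\<close>] by (auto simp: b_def dist_real_def)
      then show ?thesis using s d by auto
    qed
  qed
  have dTI: "(TI has_vector_derivative TI1) (at 0)"
    using first_order_expansion_derivative[OF time_expansion] .
  have start: "((\<lambda>\<epsilon>. v \<epsilon> 0) has_vector_derivative vector_derivative xin (at 0)) (at 0)"
  proof (rule has_vector_derivative_transform_within_open)
    show "(xin has_vector_derivative vector_derivative xin (at 0)) (at 0)"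
      using first_order_expansion_derivative[OF entry_expansion] .
  qed (use \<open>open J\<close> \<open>0 \<in> J\<close> entry_point in \<open>auto simp: v_def\<close>)
  have transport: "\<eta> 0 (v \<epsilon> s) \<bullet> F 0 (v \<epsilon> s) = -1"
    if "\<epsilon> \<in> J" "0 < s" "s < TI \<epsilon>" "v \<epsilon> s \<in> U" for \<epsilon> s
  proof (rule timing_transport_equation[OF F_C1 \<open>open J\<close> \<open>0 \<in> J\<close> \<open>open \<Omega>\<close> region(1) _ T0 nbhd(1) that(4)])
    show "v \<epsilon> s \<in> R" using pass(3)[OF that(1)] that TI by (auto simp: v_def)
  qed (use boundary in auto)
  have exit: "\<T> 0 (v \<epsilon> (TI \<epsilon>)) = 0" if "\<epsilon> \<in> J" "v \<epsilon> (TI \<epsilon>) \<in> U" for \<epsilon>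
  proof (rule exit_time_on_exit_surface)
    show "v \<epsilon> (TI \<epsilon>) \<in> \<Sigma>out" using pass(2) TI that by (simp add: v_def)
    then show "exits_after (F 0) \<Omega> R \<Sigma>out (v \<epsilon> (TI \<epsilon>)) (\<T> 0 (v \<epsilon> (TI \<epsilon>)))"
      using T0 that unfolding local_timing_response_def by blast
  qed
  have traj: "trajectory_on (F \<epsilon>) \<Omega> (v \<epsilon>) {0..b}" if "\<epsilon> \<in> J" for \<epsilon>
    unfolding v_def by (rule trajectory_shift[OF orbit[OF that]]) simp
  have cont: "isCont TI 0" using dTI has_vector_derivative_continuous by blast
  have "(TI has_real_derivative \<eta> 0 (v 0 0) \<bullet> vector_derivative xin (at 0)
      + integral {0..TI 0} (\<lambda>s. \<eta> 0 (v 0 s) \<bullet> vector_derivative (\<lambda>\<epsilon>. F \<epsilon> (v 0 s)) (at 0))) (at 0)"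
  proof (rule transit_time_derivative[where J = J and U = U and b = b and T = "\<T> 0",
        OF F_C1 \<open>open J\<close> \<open>0 \<in> J\<close> \<open>open \<Omega>\<close> nbhd(1,3)])
    show "\<And>x. x \<in> U \<Longrightarrow> GDERIV (\<T> 0) x :> \<eta> 0 x" "continuous_on U (\<eta> 0)"
      using T0 unfolding local_timing_response_def by auto
    show "TI 0 < b" using d(1) by (simp add: b_def)
  qed (use traj inU cont TI(2) \<open>0 \<in> J\<close> transport exit start in auto)
  then have "TI1 = \<eta> 0 (v 0 0) \<bullet> vector_derivative xin (at 0)
      + integral {0..TI 0} (\<lambda>s. \<eta> 0 (v 0 s) \<bullet> vector_derivative (\<lambda>\<epsilon>. F \<epsilon> (v 0 s)) (at 0))"
    using dTI DERIV_unique unfolding has_real_derivative_iff_has_vector_derivative[symmetric] by blast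
  moreover have "v 0 0 = xin 0" using entry_point \<open>0 \<in> J\<close> by (simp add: v_def)
  moreover have "integral {0..TI 0} (\<lambda>s. \<eta> 0 (v 0 s) \<bullet> vector_derivative (\<lambda>\<epsilon>. F \<epsilon> (v 0 s)) (at 0))
      = integral {tin 0..tout 0} (\<lambda>t. \<eta> 0 (\<gamma> 0 t) \<bullet> vector_derivative (\<lambda>\<epsilon>. F \<epsilon> (\<gamma> 0 t)) (at 0))"
    using integral_shift_Icc_real[of 0 "TI 0"
        "\<lambda>t. \<eta> 0 (\<gamma> 0 t) \<bullet> vector_derivative (\<lambda>\<epsilon>. F \<epsilon> (\<gamma> 0 t)) (at 0)" "tin 0"] TI(1)[OF \<open>0 \<in> J\<close>]
    by (simp add: o_def v_def)
  ultimately show ?thesis by simp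
qed

end
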